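(* Let the number $M$ of base station clusters in the main-lobe antenna footprint $\mathcal{B}_{(ml)}$ be Poisson distributed with mean $\Lambda=\lambda_c\,\mathrm{v}^2(\mathcal{B}_{(ml)})$, where $\mathrm{v}^2$ is Lebesgue (area) measure and $\mathrm{v}^2(\mathcal{B}_{(ml)})=40^2$, and let all clusters be at the same distance $d_{(ml)}$ from the satellite. Let $T_{(ml)}=\sum_{i=1}^{M}T_{cluster,i}$, where $T_{cluster,1},T_{cluster,2},\dots$ are i.i.d. copies of $T_{cluster}$ with distance $x=d_{(ml)}$ and antenna gain $g=g_{(ml)}$, independent of $M$. Then, for every real $\eta$ for which $M_{cluster}(\eta;d_{(ml)},g_{(ml)})$ is finite, the moment generating function $M_{(ml)}(\eta)=\mathbb{E}[e^{\eta T_{(ml)}}]$ is $$M_{(ml)}(\eta)=\exp\left(40^{2}\lambda_{c}\left(-1+M_{cluster}(\eta;\,d_{(ml)},\,g_{(ml)})\right)\right).$$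
   Context: Constants $\omega>0$, $\alpha>2$, $\lambda_c>0$ (cluster intensity per km$^2$), $\lambda_{BS}>0$, $g_{(ml)}>0$, Earth radius $r_e>0$ and satellite distance to the Earth's center $h>r_e$ are given. $d_{(ml)}$ is the positive root $d$ of $d^2+2d\,r_e\cos(40^\circ)+r_e^2-h^2=0$. A base station (BS) at distance $x>0$ from the satellite, seen with antenna gain $g>0$, contributes RFI brightness temperature $g\omega|H|^2x^{-\alpha}$, where $|H|^2$ is the random channel power gain. A cluster at distance $x$ contributes $T_{cluster}=\sum_{j=1}^{N}g\omega|H_j|^2x^{-\alpha}$, where $N\sim\mathrm{Pois}(\lambda_{BS})$ and the $|H_j|^2$ are i.i.d. and independent of $N$. Its moment generating function is $M_{cluster}(\eta;x,g)=\exp(\lambda_{BS}(-1+M_{BS}(\eta;x,g)))$ with $M_{BS}(\eta;x,g)=\mathbb{E}[e^{\eta g\omega|H|^2x^{-\alpha}}]$. The channel is either shadowed Rician with parameters $(\Omega,2b_0,m)$, meaning $|H|^2$ has density $\frac{1}{2b_0}\left(\frac{2b_0m}{2b_0m+\Omega}\right)^m e^{-t/(2b_0)}\,{}_1F_1\left(m;1;\frac{\Omega t}{2b_0(2b_0m+\Omega)}\right)$ on $t>0$ ($b_0,m,\Omega>0$), or Rayleigh, meaning $|H|^2$ is exponential with mean $2b_0$. *)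

theory Defs
  imports "HOL-Probability.Probability"
begin

text \<open>Kummer's confluent hypergeometric function \<open>1F1(a; b; z)\<close>.\<close>

definition hyp1F1 :: "real \<Rightarrow> real \<Rightarrow> real \<Rightarrow> real" where
  "hyp1F1 a b z = (\<Sum>n. pochhammer a n / (pochhammer b n * fact n) * z ^ n)"

text \<open>
  The arguments are \<open>Omega\<close>, \<open>b0\<close>, \<open>m\<close> for the shadowed Rician channel and \<open>b0\<close> for the
  Rayleigh channel. The scale that occurs in the literature is \<open>2 * b0\<close>.
\<close>

datatype channel = Shadowed_Rician real real real | Rayleigh real

fun valid_channel :: "channel \<Rightarrow> bool" where
  "valid_channel (Shadowed_Rician Om b0 m) \<longleftrightarrow> Om > 0 \<and> b0 > 0 \<and> m > 0"
| "valid_channel (Rayleigh b0) \<longleftrightarrow> b0 > 0"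

text \<open>Density of the channel power gain; \<open>exponential_density\<close> takes the rate, not the mean.\<close>

fun gain_density :: "channel \<Rightarrow> real \<Rightarrow> real" where
  "gain_density (Shadowed_Rician Om b0 m) t =
     (if t > 0
      then 1 / (2 * b0) * (2 * b0 * m / (2 * b0 * m + Om)) powr m * exp (- t / (2 * b0)) *
           hyp1F1 m 1 (Om * t / (2 * b0 * (2 * b0 * m + Om)))
      else 0)"
| "gain_density (Rayleigh b0) t = exponential_density (1 / (2 * b0)) t"

definition gain_law :: "channel \<Rightarrow> real measure" where
  "gain_law ch = density lborel (\<lambda>t. ennreal (gain_density ch t))"

definition BS_RFI :: "real \<Rightarrow> real \<Rightarrow> real \<Rightarrow> real \<Rightarrow> real \<Rightarrow> real" where
  "BS_RFI \<omega> \<alpha> x g t = g * \<omega> * t * x powr (- \<alpha>)"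

definition cluster_RFI ::
  "real \<Rightarrow> real \<Rightarrow> real \<Rightarrow> real \<Rightarrow> ('a \<Rightarrow> nat) \<Rightarrow> (nat \<Rightarrow> 'a \<Rightarrow> real) \<Rightarrow> 'a \<Rightarrow> real" where
  "cluster_RFI \<omega> \<alpha> x g N H s = (\<Sum>j<N s. BS_RFI \<omega> \<alpha> x g (H j s))"

text \<open>
  Moment generating functions take values in \<^typ>\<open>ennreal\<close>, so that a divergent
  expectation is \<open>\<infinity>\<close> rather than the default value of the Bochner integral.
\<close>

definition mgf :: "'a measure \<Rightarrow> ('a \<Rightarrow> real) \<Rightarrow> real \<Rightarrow> ennreal" where
  "mgf S X \<eta> = (\<integral>\<^sup>+ s. ennreal (exp (\<eta> * X s)) \<partial>S)"

definition M_BS :: "channel \<Rightarrow> real \<Rightarrow> real \<Rightarrow> real \<Rightarrow> real \<Rightarrow> real \<Rightarrow> ennreal" where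
  "M_BS ch \<omega> \<alpha> \<eta> x g = mgf (gain_law ch) (BS_RFI \<omega> \<alpha> x g) \<eta>"

text \<open>This is \<open>exp (lambda_BS * (-1 + M_BS))\<close>, where \<open>exp \<infinity> = \<infinity>\<close> and \<open>lambda_BS > 0\<close>.\<close>

definition M_cluster :: "channel \<Rightarrow> real \<Rightarrow> real \<Rightarrow> real \<Rightarrow> real \<Rightarrow> real \<Rightarrow> real \<Rightarrow> ennreal" where
  "M_cluster ch \<omega> \<alpha> lambda_BS \<eta> x g =
     (if M_BS ch \<omega> \<alpha> \<eta> x g = \<infinity> then \<infinity>
      else ennreal (exp (lambda_BS * (- 1 + enn2real (M_BS ch \<omega> \<alpha> \<eta> x g)))))"

text \<open>
  A count and a sequence of real random variables are jointly independent. The count is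
  embedded into the reals because \<open>indep_vars\<close> needs a common value type.
\<close>

definition (in prob_space) indep_count_seq :: "('a \<Rightarrow> nat) \<Rightarrow> (nat \<Rightarrow> 'a \<Rightarrow> real) \<Rightarrow> bool" where
  "indep_count_seq N X \<longleftrightarrow>
     indep_vars (\<lambda>_. borel) (case_option (\<lambda>s. real (N s)) X) (UNIV :: nat option set)"

end

theory Submission
  imports Defs
begin

text \<open>
  Conditionally on the number of summands, independence turns the moment generating function of a
  random sum into a power; averaging these powers over a Poisson law gives the exponential series.
  This compound Poisson formula is applied to the base stations of one cluster and then to the
  clusters of the footprint.
\<close>

text \<open>This is the probability generating function of the Poisson law at \<open>c\<close>: the
  weight \<open>exp (- l) * l ^ n / fact n\<close> absorbs \<open>c ^ n\<close> into the exponential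
  series of \<open>l * c\<close>.\<close>

lemma suminf_poisson_power:
  assumes "0 < l" "0 \<le> c"
  shows "(\<Sum>n. ennreal (pmf (poisson_pmf l) n) * ennreal c ^ n) = ennreal (exp (l * (-1 + c)))"
proof -
  have "(\<lambda>n. exp (- l) * ((l * c) ^ n /\<^sub>R fact n)) sums (exp (- l) * exp (l * c))"
    by (intro sums_mult exp_converges)
  moreover have "exp (- l) * ((l * c) ^ n /\<^sub>R fact n) = pmf (poisson_pmf l) n * c ^ n" for n
    using assms by (simp add: field_simps)
  moreover have "exp (- l) * exp (l * c) = exp (l * (-1 + c))"
    by (simp add: mult_exp_exp algebra_simps)
  ultimately have "(\<lambda>n. pmf (poisson_pmf l) n * c ^ n) sums exp (l * (-1 + c))"
    by (simp only:)
  then show ?thesis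
    using assms by (simp add: ennreal_power ennreal_mult [symmetric] suminf_ennreal_eq sums_iff)
qed

lemma mgf_distr:
  assumes "g \<in> measurable S L" "f \<in> borel_measurable L"
  shows "mgf (distr S L g) f \<eta> = mgf S (\<lambda>s. f (g s)) \<eta>"
  using assms unfolding mgf_def by (subst nn_integral_distr) auto

context prob_space
begin

lemma indep_count_seqD_measurable:
  assumes "indep_count_seq N X"
  shows "X i \<in> borel_measurable M"
proof -
  have "random_variable borel (case_option (\<lambda>s. real (N s)) X (Some i))"
    using assms unfolding indep_count_seq_def indep_vars_def2 by blast
  then show ?thesis by simp
qed

text \<open>Once \<open>n\<close> is fixed, only the count and the first \<open>n\<close> variables
  are involved, so finite joint independence splits the integral. Working in \<open>ennreal\<close>
  avoids any integrability condition.\<close>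

lemma nn_integral_count_prod:
  assumes indep: "indep_count_seq N X"
    and N[measurable]: "N \<in> measurable M (count_space UNIV)"
    and u[measurable]: "u \<in> borel_measurable borel"
  shows "(\<integral>\<^sup>+ s. indicator {n} (N s) * (\<Prod>i<n. u (X i s)) \<partial>M) =
    emeasure M {s \<in> space M. N s = n} * (\<Prod>i<n. \<integral>\<^sup>+ s. u (X i s) \<partial>M)"
proof -
  \<comment> \<open>The event that the count equals \<open>n\<close> becomes one more factor of the
    independent family, at index \<open>None\<close>. It is tested on the real embedding of the
    count, which is harmless because \<open>real\<close> is injective on naturals.\<close>
  define v :: "nat option \<Rightarrow> real \<Rightarrow> ennreal"
    where "v = case_option (indicator {real n}) (\<lambda>_. u)"
  define Y where "Y = (\<lambda>k s. v k (case_option (\<lambda>s. real (N s)) X k s))"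
  let ?I = "insert None (Some ` {..<n})"
  have v: "v k \<in> borel_measurable borel" for k
    by (cases k) (auto simp: v_def)
  have "indep_vars (\<lambda>_. borel) (case_option (\<lambda>s. real (N s)) X) ?I"
    using indep unfolding indep_count_seq_def by (rule indep_vars_subset) auto
  then have "indep_vars (\<lambda>_. borel) Y ?I"
    unfolding Y_def by (rule indep_vars_compose2) (rule v)
  then have "(\<integral>\<^sup>+ s. (\<Prod>k\<in>?I. Y k s) \<partial>M) = (\<Prod>k\<in>?I. \<integral>\<^sup>+ s. Y k s \<partial>M)"
    by (intro indep_vars_nn_integral) auto
  moreover have "(\<Prod>k\<in>?I. w k) = w None * (\<Prod>i<n. w (Some i))" for w :: "nat option \<Rightarrow> ennreal"
    by (subst prod.insert) (auto simp: prod.reindex)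
  moreover have "Y None = (\<lambda>s. indicator {n} (N s))" "Y (Some i) = (\<lambda>s. u (X i s))" for i
    by (auto simp: Y_def v_def split: split_indicator)
  moreover have "(\<integral>\<^sup>+ s. indicator {n} (N s) \<partial>M) = emeasure M {s \<in> space M. N s = n}"
  proof -
    have "(\<integral>\<^sup>+ s. indicator {n} (N s) \<partial>M) = (\<integral>\<^sup>+ s. indicator {s \<in> space M. N s = n} s \<partial>M)"
      by (intro nn_integral_cong) (simp split: split_indicator)
    then show ?thesis by simp
  qed
  ultimately show ?thesis by simp
qed

text \<open>The map \<open>f\<close> lets one statement serve both levels: the RFI of a base station
  as a function of its gain, and the identity for whole clusters.\<close>

lemma mgf_compound_poisson:
  assumes indep: "indep_count_seq N X"
    and N[measurable]: "N \<in> measurable M (count_space UNIV)"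
    and poisson: "distr M (count_space UNIV) N = measure_pmf (poisson_pmf l)"
    and f[measurable]: "f \<in> borel_measurable borel"
    and mgf: "\<And>i. mgf M (\<lambda>s. f (X i s)) \<eta> = ennreal c"
    and "0 < l" "0 \<le> c"
  shows "mgf M (\<lambda>s. \<Sum>i<N s. f (X i s)) \<eta> = ennreal (exp (l * (-1 + c)))"
proof -
  note [measurable] = indep_count_seqD_measurable [OF indep]
  define u where "u = (\<lambda>x. ennreal (exp (\<eta> * f x)))"
  have u[measurable]: "u \<in> borel_measurable borel"
    unfolding u_def by measurable
  have meas: "(\<lambda>s. indicator {n} (N s) * (\<Prod>i<n. u (X i s))) \<in> borel_measurable M" for n
    by (intro borel_measurable_times_ennreal borel_measurable_prod_ennreal
        measurable_compose [OF N] measurable_compose [OF _ u]) auto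
  \<comment> \<open>Only the term with \<open>n = N s\<close> survives in the series, and there
    \<open>exp\<close> turns the sum into a product.\<close>
  have "ennreal (exp (\<eta> * (\<Sum>i<N s. f (X i s)))) =
      (\<Sum>n. indicator {n} (N s) * (\<Prod>i<n. u (X i s)))" for s
  proof -
    have "(\<Sum>n. indicator {n} (N s) * (\<Prod>i<n. u (X i s))) =
        (\<Sum>n\<in>{N s}. indicator {n} (N s) * (\<Prod>i<n. u (X i s)))"
      by (rule suminf_finite) auto
    then show ?thesis
      by (simp add: u_def prod_ennreal exp_sum sum_distrib_left)
  qed
  \<comment> \<open>Series and integral are exchanged by monotone convergence, as all terms are
    nonnegative and measurable.\<close>
  then have "mgf M (\<lambda>s. \<Sum>i<N s. f (X i s)) \<eta> =
      (\<Sum>n. \<integral>\<^sup>+ s. indicator {n} (N s) * (\<Prod>i<n. u (X i s)) \<partial>M)"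
    unfolding mgf_def by (simp add: nn_integral_suminf [OF meas])
  also have "\<dots> = (\<Sum>n. emeasure M {s \<in> space M. N s = n} * ennreal c ^ n)"
    using mgf by (subst nn_integral_count_prod [OF indep N u]) (simp add: mgf_def u_def)
  also have "\<dots> = (\<Sum>n. ennreal (pmf (poisson_pmf l) n) * ennreal c ^ n)"
  proof -
    have "emeasure M {s \<in> space M. N s = n} = ennreal (pmf (poisson_pmf l) n)" for n
      using emeasure_distr [OF N, of "{n}"]
      by (simp add: poisson emeasure_pmf_single vimage_def Int_def conj_commute)
    then show ?thesis by simp
  qed
  also have "\<dots> = ennreal (exp (l * (-1 + c)))"
    using assms by (intro suminf_poisson_power)
  finally show ?thesis .
qed

text \<open>Inner level of the compound Poisson formula. Finiteness of \<open>M_BS\<close> provides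
  the real number \<open>c\<close> that the formula asks for.\<close>

lemma mgf_cluster_RFI:
  assumes "indep_count_seq N H"
    and "N \<in> measurable M (count_space UNIV)"
    and "distr M (count_space UNIV) N = measure_pmf (poisson_pmf lambda_BS)"
    and H: "\<And>j. distributed M lborel (H j) (\<lambda>t. ennreal (gain_density ch t))"
    and "0 < lambda_BS"
    and finite: "M_BS ch \<omega> \<alpha> \<eta> x g \<noteq> \<infinity>"
  shows "mgf M (cluster_RFI \<omega> \<alpha> x g N H) \<eta> = M_cluster ch \<omega> \<alpha> lambda_BS \<eta> x g"
proof -
  have f: "BS_RFI \<omega> \<alpha> x g \<in> borel_measurable borel"
    unfolding BS_RFI_def by measurable
  have "mgf M (\<lambda>s. BS_RFI \<omega> \<alpha> x g (H j s)) \<eta> = ennreal (enn2real (M_BS ch \<omega> \<alpha> \<eta> x g))" for j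
  proof -
    have "H j \<in> measurable M lborel" "distr M lborel (H j) = gain_law ch"
      using H [of j] by (auto simp: distributed_def gain_law_def)
    with f have "mgf M (\<lambda>s. BS_RFI \<omega> \<alpha> x g (H j s)) \<eta> = M_BS ch \<omega> \<alpha> \<eta> x g"
      unfolding M_BS_def by (subst mgf_distr [of "H j" M lborel, symmetric]) auto
    with finite show ?thesis by (simp add: less_top)
  qed
  from mgf_compound_poisson [OF assms(1-3) f this] \<open>0 < lambda_BS\<close> finite show ?thesis
    by (simp add: M_cluster_def cluster_RFI_def [abs_def])
qed

end

theorem lemma4:
  fixes \<omega> \<alpha> lambda_c lambda_BS g_ml r_e h d_ml \<eta> :: real
    and ch :: channel
    and B :: "(real ^ 2) set"
    and P :: "'a measure" and N :: "'a \<Rightarrow> nat" and H :: "nat \<Rightarrow> 'a \<Rightarrow> real"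
    and Q :: "'b measure" and M :: "'b \<Rightarrow> nat" and T :: "nat \<Rightarrow> 'b \<Rightarrow> real"
  assumes "\<omega> > 0" "\<alpha> > 2" "lambda_c > 0" "lambda_BS > 0" "g_ml > 0" "r_e > 0" "h > r_e"
    and "d_ml > 0" "d_ml\<^sup>2 + 2 * d_ml * r_e * cos (40 * pi / 180) + r_e\<^sup>2 - h\<^sup>2 = 0"
    and "valid_channel ch"
    and "B \<in> lmeasurable" "measure lebesgue B = 40\<^sup>2"
    \<comment> \<open>a generic cluster, on its own probability space\<close>
    and "prob_space P"
    and "N \<in> measurable P (count_space UNIV)"
    and "distr P (count_space UNIV) N = measure_pmf (poisson_pmf lambda_BS)"
    and "\<And>j. distributed P lborel (H j) (\<lambda>t. ennreal (gain_density ch t))"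
    and "prob_space.indep_count_seq P N H"
    \<comment> \<open>the clusters in the main-lobe footprint\<close>
    and "prob_space Q"
    and "M \<in> measurable Q (count_space UNIV)"
    and "distr Q (count_space UNIV) M =
           measure_pmf (poisson_pmf (lambda_c * measure lebesgue B))"
    and "\<And>i. T i \<in> borel_measurable Q"
    and "\<And>i. distr Q borel (T i) = distr P borel (cluster_RFI \<omega> \<alpha> d_ml g_ml N H)"
    and "prob_space.indep_count_seq Q M T"
    and "M_cluster ch \<omega> \<alpha> lambda_BS \<eta> d_ml g_ml < \<infinity>"
  shows "mgf Q (\<lambda>s. \<Sum>i<M s. T i s) \<eta> =
           ennreal (exp (40\<^sup>2 * lambda_c *
             (- 1 + enn2real (M_cluster ch \<omega> \<alpha> lambda_BS \<eta> d_ml g_ml))))"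
proof -
  interpret P: prob_space P by fact
  interpret Q: prob_space Q by fact
  let ?C = "M_cluster ch \<omega> \<alpha> lambda_BS \<eta> d_ml g_ml"
  let ?Z = "cluster_RFI \<omega> \<alpha> d_ml g_ml N H"
  \<comment> \<open>\<open>M_cluster\<close> is set to \<infinity> whenever \<open>M_BS\<close> is,
    so finiteness passes from the cluster to the single base station.\<close>
  have "M_BS ch \<omega> \<alpha> \<eta> d_ml g_ml \<noteq> \<infinity>"
    using assms(24) by (auto simp: M_cluster_def)
  then have cluster: "mgf P ?Z \<eta> = ?C"
    using assms by (intro P.mgf_cluster_RFI) auto
  have H: "H j \<in> borel_measurable P" for j
    using assms(17) by (rule P.indep_count_seqD_measurable)
  \<comment> \<open>The number of summands is random, but it takes countably many values, and for
    each of them the sum is finite and measurable.\<close>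
  have Z: "?Z \<in> borel_measurable P"
  proof -
    have "(\<lambda>s. \<Sum>j<n. BS_RFI \<omega> \<alpha> d_ml g_ml (H j s)) \<in> borel_measurable P" for n
      unfolding BS_RFI_def using H by (intro borel_measurable_sum) simp
    from measurable_compose_countable [OF this assms(14)] show ?thesis
      by (simp add: cluster_RFI_def [abs_def])
  qed
  have "mgf Q (\<lambda>s. T i s) \<eta> = ennreal (enn2real ?C)" for i
  proof -
    \<comment> \<open>\<open>T i\<close> and the generic cluster live on different probability
      spaces; the moment generating function is carried across through their common law on the
      reals.\<close>
    have "mgf Q (\<lambda>s. T i s) \<eta> = mgf (distr Q borel (T i)) (\<lambda>x. x) \<eta>"
      using assms(21) by (subst mgf_distr) auto
    also have "\<dots> = mgf P ?Z \<eta>"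
      using Z by (simp add: assms(22) mgf_distr)
    finally show ?thesis
      using assms(24) by (simp add: cluster)
  qed
  \<comment> \<open>Outer level, with \<open>f\<close> the identity and Poisson mean
    \<open>lambda_c\<close> times the area \<open>40\<^sup>2\<close>.\<close>
  from Q.mgf_compound_poisson [OF assms(23,19,20), of "\<lambda>x. x", OF _ this]
  show ?thesis
    using assms(3,12) by (simp add: mult.commute)
qed

end
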